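(* Every finitely presented group admitting an epimorphism onto the Grigorchuk group $\mathfrak G$ is large.
   Context: Let $X=\{0,1\}$ and $X^*$ the set of finite binary words (the binary rooted tree). The Grigorchuk group $\mathfrak G$ is the group of automorphisms of $X^*$ generated by $a,b,c,d$ defined recursively by: $a(0w)=1w$, $a(1w)=0w$; $b(0w)=0\,a(w)$, $b(1w)=1\,c(w)$; $c(0w)=0\,a(w)$, $c(1w)=1\,d(w)$; $d(0w)=0w$, $d(1w)=1\,b(w)$ (each fixing the empty word). A group is large if it has a finite-index subgroup admitting an epimorphism onto a non-abelian free group. *)

theory Defs
  imports "HOL-Algebra.Algebra"
begin

text \<open>Binary words are bool lists, with False = 0 and True = 1; the head of the
list is the first letter (the letter at the root).\<close>

fun ga :: "bool list \<Rightarrow> bool list" where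
  "ga [] = []"
| "ga (x # w) = (\<not> x) # w"

fun gb :: "bool list \<Rightarrow> bool list"
and gc :: "bool list \<Rightarrow> bool list"
and gd :: "bool list \<Rightarrow> bool list" where
  "gb [] = []"
| "gb (False # w) = False # ga w"
| "gb (True # w) = True # gc w"
| "gc [] = []"
| "gc (False # w) = False # ga w"
| "gc (True # w) = True # gd w"
| "gd [] = []"
| "gd (False # w) = False # w"
| "gd (True # w) = True # gb w"

definition grigorchuk :: "(bool list \<Rightarrow> bool list) monoid" where
  "grigorchuk = (BijGroup (UNIV :: bool list set))
     \<lparr>carrier := generate (BijGroup (UNIV :: bool list set)) {ga, gb, gc, gd}\<rparr>"

text \<open>Words over the alphabet X with letters (x, True) = x and (x, False) = x^-1.
Free reduction (cancellation of adjacent inverse letters):\<close>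

fun free_red :: "('x \<times> bool) list \<Rightarrow> ('x \<times> bool) list" where
  "free_red [] = []"
| "free_red (l # w) =
     (case free_red w of
        [] \<Rightarrow> [l]
      | m # v \<Rightarrow> (if fst m = fst l \<and> snd m \<noteq> snd l then v else l # m # v))"

definition free_group :: "'x set \<Rightarrow> ('x \<times> bool) list monoid" where
  "free_group B = \<lparr>carrier = {w. fst ` set w \<subseteq> B \<and> free_red w = w},
                   monoid.mult = (\<lambda>u v. free_red (u @ v)),
                   one = []\<rparr>"

definition normal_closure :: "('a, 'b) monoid_scheme \<Rightarrow> 'a set \<Rightarrow> 'a set" where
  "normal_closure F R =
     generate F {monoid.mult F (monoid.mult F g r) (m_inv F g) | g r. g \<in> carrier F \<and> r \<in> R}"

definition finitely_presented :: "('a, 'b) monoid_scheme \<Rightarrow> bool" where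
  "finitely_presented G \<longleftrightarrow>
     (\<exists>(n::nat) \<phi> R.
        \<phi> \<in> hom (free_group {..<n}) G \<and>
        \<phi> ` carrier (free_group {..<n}) = carrier G \<and>
        finite R \<and> R \<subseteq> carrier (free_group {..<n}) \<and>
        kernel (free_group {..<n}) G \<phi> = normal_closure (free_group {..<n}) R)"

definition large :: "('a, 'b) monoid_scheme \<Rightarrow> bool" where
  "large G \<longleftrightarrow>
     (\<exists>H. subgroup H G \<and> finite (RCOSETS G H) \<and>
        (\<exists>(B::nat set) h. (\<exists>x\<in>B. \<exists>y\<in>B. x \<noteq> y) \<and>
           h \<in> hom (G\<lparr>carrier := H\<rparr>) (free_group B) \<and>
           h ` H = carrier (free_group B)))"

end

theory Submission
  imports Defs
begin

text \<open>
  Replace the subtree below each vertex of level \<open>n\<close> by a copy of a fixed action of the free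
  product of a group of order two and a Klein four-group (generated by \<open>a\<close> and by \<open>b\<close>, \<open>c\<close>, \<open>d\<close>), and
  let the four letters act through the wreath recursion. Since the recursion is contracting, every
  word that is trivial in the Grigorchuk group is trivial in these groups for all large \<open>n\<close>. As
  only finitely many relations have to be checked, a finitely presented group over the Grigorchuk
  group maps onto one of them. The recursion is also self-replicating: the stabiliser of the vertex
  \<open>1\<^sup>n\<close> maps onto the group at the leaves, and that one is virtually free of rank two.
\<close>

section \<open>Free groups\<close>

text \<open>Left multiplication of a reduced word by a letter. Reduction is then a
  \<open>foldr\<close>, so words act on the set of reduced words and the group laws can be read off
  this action, as in van der Waerden's proof.\<close>

definition free_step :: "'x \<times> bool \<Rightarrow> ('x \<times> bool) list \<Rightarrow> ('x \<times> bool) list" where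
  "free_step l w = (case w of [] \<Rightarrow> [l]
     | m # v \<Rightarrow> if fst m = fst l \<and> snd m \<noteq> snd l then v else l # m # v)"

lemma free_red_Cons: "free_red (l # w) = free_step l (free_red w)"
  by (simp add: free_step_def)

declare free_red.simps(2) [simp del]

lemma free_red_append: "free_red (u @ v) = foldr free_step u (free_red v)"
  by (induction u) (simp_all add: free_red_Cons)

lemma free_red_singleton [simp]: "free_red [l] = [l]"
  by (simp add: free_red_Cons free_step_def)

lemma length_free_step: "length (free_step l w) \<le> Suc (length w)"
  by (auto simp: free_step_def split: list.split)

lemma length_free_red: "length (free_red w) \<le> length w"
proof (induction w)
  case (Cons l w)
  then show ?case
    using length_free_step[of l "free_red w"] by (simp add: free_red_Cons)
qed simp

lemma set_free_red: "set (free_red w) \<subseteq> set w"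
proof (induction w)
  case (Cons l w)
  have "set (free_step l (free_red w)) \<subseteq> insert l (set (free_red w))"
    by (auto simp: free_step_def split: list.split)
  with Cons show ?case by (auto simp: free_red_Cons)
qed simp

text \<open>A cancellation at the head would leave a word shorter than \<open>w\<close>, not
  \<open>l # w\<close>.\<close>

lemma reduced_tail:
  assumes "free_red (l # w) = l # w"
  shows "free_red w = w"
proof -
  have "free_step l (free_red w) = l # w"
    using assms by (simp add: free_red_Cons)
  moreover have "length (free_red w) \<le> length w" by (rule length_free_red)
  ultimately show ?thesis
    by (auto simp: free_step_def split: list.splits if_splits)
qed

lemma reduced_free_step:
  assumes "free_red w = w"
  shows "free_red (free_step l w) = free_step l w"
proof (cases w)
  case (Cons m v)
  then have "free_red v = v" using assms reduced_tail by blast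
  then show ?thesis
    using assms Cons by (simp add: free_step_def free_red_Cons)
qed (simp add: free_step_def)

lemma free_red_idem [simp]: "free_red (free_red w) = free_red w"
  by (induction w) (simp_all add: free_red_Cons reduced_free_step)

lemma reduced_foldr_free_step:
  "free_red w = w \<Longrightarrow> free_red (foldr free_step u w) = foldr free_step u w"
  by (induction u) (simp_all add: reduced_free_step)

text \<open>On reduced words inverse letters act as inverse maps. If \<open>m\<close> removes the
  head \<open>k\<close>, then \<open>k = l\<close>, and since \<open>k # v\<close> is reduced,
  \<open>l\<close> goes back on without a further cancellation.\<close>

lemma free_step_cancel:
  assumes "free_red w = w" "fst m = fst l" "snd m \<noteq> snd l"
  shows "free_step l (free_step m w) = w"
proof (cases w)
  case Nil
  then show ?thesis using assms by (simp add: free_step_def)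
next
  case (Cons k v)
  have v: "free_step k v = k # v"
    using assms(1) reduced_tail[of k v] Cons by (simp add: free_red_Cons)
  show ?thesis
  proof (cases "fst k = fst m \<and> snd k \<noteq> snd m")
    case True
    then have "k = l" using assms by (auto simp: prod_eq_iff)
    then show ?thesis using True Cons v by (simp add: free_step_def)
  next
    case False
    then have "free_step m w = m # w" using Cons by (auto simp: free_step_def)
    then show ?thesis using assms by (simp add: free_step_def)
  qed
qed

text \<open>A cancelling pair acts trivially on reduced words, so it may be dropped from the acting
  word; associativity rests on this.\<close>

lemma foldr_free_step_free_step:
  assumes "free_red z = z"
  shows "foldr free_step (free_step l w) z = free_step l (foldr free_step w z)"
proof (cases w)
  case (Cons m v)
  have "free_red (foldr free_step v z) = foldr free_step v z"
    by (rule reduced_foldr_free_step) fact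
  then show ?thesis
    using Cons by (auto simp: free_step_def[of l "m # v"] free_step_cancel)
qed (simp add: free_step_def)

lemma free_red_append_left [simp]: "free_red (free_red u @ v) = free_red (u @ v)"
proof -
  have "foldr free_step (free_red u) (free_red v) = foldr free_step u (free_red v)"
    by (induction u) (simp_all add: free_red_Cons foldr_free_step_free_step)
  then show ?thesis by (simp add: free_red_append)
qed

lemma free_red_append_right [simp]: "free_red (u @ free_red v) = free_red (u @ v)"
  by (simp add: free_red_append)

section \<open>Inverses and the group structure\<close>

definition word_inv :: "('x \<times> bool) list \<Rightarrow> ('x \<times> bool) list" where
  "word_inv u = rev (map (\<lambda>(x, b). (x, \<not> b)) u)"

lemma free_red_word_inv_append: "free_red (word_inv u @ u) = []"
proof -
  have "foldr free_step (word_inv u) (foldr free_step u z) = z" if "free_red z = z" for z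
    using that
  proof (induction u)
    case (Cons l u)
    have "free_red (foldr free_step u z) = foldr free_step u z"
      using Cons.prems by (rule reduced_foldr_free_step)
    then show ?case
      using Cons by (simp add: word_inv_def free_step_cancel split: prod.split)
  qed (simp add: word_inv_def)
  from this[of "[]"] show ?thesis
    using free_red_append[of u "[]"] by (simp add: free_red_append)
qed

lemma group_free_group: "group (free_group B)"
proof (rule groupI)
  fix x assume "x \<in> carrier (free_group B)"
  then have x: "fst ` set x \<subseteq> B" by (simp add: free_group_def)
  have "fst ` set (free_red (word_inv x)) \<subseteq> fst ` set (word_inv x)"
    using set_free_red by blast
  also have "\<dots> = fst ` set x"
    by (force simp: word_inv_def image_iff)
  finally have "free_red (word_inv x) \<in> carrier (free_group B)"
    using x by (simp add: free_group_def)
  then show "\<exists>y\<in>carrier (free_group B). y \<otimes>\<^bsub>free_group B\<^esub> x = \<one>\<^bsub>free_group B\<^esub>"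
    by (intro bexI[of _ "free_red (word_inv x)"])
       (simp_all add: free_group_def free_red_word_inv_append)
next
  fix x y assume "x \<in> carrier (free_group B)" "y \<in> carrier (free_group B)"
  then show "x \<otimes>\<^bsub>free_group B\<^esub> y \<in> carrier (free_group B)"
    using image_mono[OF set_free_red[of "x @ y"], of fst]
    unfolding free_group_def by (simp add: image_Un) blast
qed (auto simp: free_group_def)

lemma free_group_Cons:
  assumes "l # w \<in> carrier (free_group B)"
  shows "[l] \<in> carrier (free_group B)" "w \<in> carrier (free_group B)"
    "l # w = [l] \<otimes>\<^bsub>free_group B\<^esub> w"
  using assms reduced_tail[of l w] by (auto simp: free_group_def)

lemma free_group_subgroup_UNIV:
  assumes "subgroup K (free_group B)" "\<And>x. x \<in> B \<Longrightarrow> [(x, True)] \<in> K"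
  shows "K = carrier (free_group B)"
proof
  interpret F: group "free_group B" by (rule group_free_group)
  show "K \<subseteq> carrier (free_group B)" using assms(1) by (rule subgroup.subset)
  have neg: "[(x, False)] \<in> K" if "x \<in> B" for x
  proof -
    have "inv\<^bsub>free_group B\<^esub> [(x, True)] = [(x, False)]"
      using that by (intro F.inv_equality)
        (auto simp: free_group_def free_red_Cons free_step_def)
    then show ?thesis
      using subgroup.m_inv_closed[OF assms(1) assms(2)[OF that]] by simp
  qed
  show "carrier (free_group B) \<subseteq> K"
  proof
    fix w assume "w \<in> carrier (free_group B)"
    then show "w \<in> K"
    proof (induction w)
      case Nil
      then show ?case
        using subgroup.one_closed[OF assms(1)] by (simp add: free_group_def)
    next
      case (Cons l w)
      note lw = free_group_Cons[OF Cons.prems]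
      have "fst l \<in> B" using lw(1) by (simp add: free_group_def)
      then have "[l] \<in> K"
        using neg[of "fst l"] assms(2)[of "fst l"] by (cases l; cases "snd l") auto
      then show ?case
        using subgroup.m_closed[OF assms(1) _ Cons.IH[OF lw(2)]] lw(3) by simp
    qed
  qed
qed

section \<open>Words in the four generators\<close>

datatype letter = La | Lb | Lc | Ld

definition act_word :: "(letter \<Rightarrow> 'p \<Rightarrow> 'p) \<Rightarrow> letter list \<Rightarrow> 'p \<Rightarrow> 'p" where
  "act_word t w = foldr t w"

lemma act_word_simps [simp]:
  "act_word t [] = id"
  "act_word t (l # w) = t l \<circ> act_word t w"
  "act_word t (u @ v) = act_word t u \<circ> act_word t v"
  by (simp_all add: act_word_def fun_eq_iff)

text \<open>The defining relations of the free product of a group of order two and a Klein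
  four-group. Every letter is an involution, so reversing a word inverts it.\<close>

definition klein :: "(letter \<Rightarrow> 'p \<Rightarrow> 'p) \<Rightarrow> bool" where
  "klein t \<longleftrightarrow> (\<forall>l p. t l (t l p) = p) \<and>
     (\<forall>p. t Lb (t Lc p) = t Ld p) \<and> (\<forall>p. t Lc (t Ld p) = t Lb p) \<and> (\<forall>p. t Ld (t Lb p) = t Lc p)"

lemma klein_square: "klein t \<Longrightarrow> t l (t l p) = p"
  by (simp add: klein_def)

lemma klein_mult:
  assumes "klein t"
  shows "t Lb (t Lc p) = t Ld p" "t Lc (t Lb p) = t Ld p"
    "t Lc (t Ld p) = t Lb p" "t Ld (t Lc p) = t Lb p"
    "t Ld (t Lb p) = t Lc p" "t Lb (t Ld p) = t Lc p"
  using assms by (simp_all add: klein_def) metis+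

lemma act_word_rev: "klein t \<Longrightarrow> act_word t (rev w) (act_word t w p) = p"
  by (induction w arbitrary: p) (simp_all add: klein_square)

lemma act_word_rev_right: "klein t \<Longrightarrow> act_word t w (act_word t (rev w) p) = p"
  using act_word_rev[of t "rev w"] by simp

lemma bij_act_word: "klein t \<Longrightarrow> bij (act_word t w)"
  by (rule o_bij[of "act_word t (rev w)"]) (auto simp: act_word_rev act_word_rev_right fun_eq_iff)

text \<open>Multiplication in the Klein four-group, whose elements are encoded by words of at most
  one letter: two distinct letters multiply to the third.\<close>

fun klein_mul :: "letter \<Rightarrow> letter list \<Rightarrow> letter list" where
  "klein_mul l [] = [l]"
| "klein_mul l (m # v) = (if l = m then [] else
     if Lb \<notin> {l, m} then [Lb] else if Lc \<notin> {l, m} then [Lc] else [Ld])"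

definition klein_nf :: "letter list \<Rightarrow> letter list" where
  "klein_nf w = foldr klein_mul w []"

lemma klein_nf_cases: "La \<notin> set w \<Longrightarrow> klein_nf w \<in> {[], [Lb], [Lc], [Ld]}"
proof (induction w)
  case (Cons l w)
  then show ?case by (cases l) (auto simp: klein_nf_def)
qed (simp add: klein_nf_def)

lemma act_word_klein_nf:
  assumes "klein t" "La \<notin> set w"
  shows "act_word t (klein_nf w) = act_word t w"
  using assms(2)
proof (induction w)
  case (Cons l w)
  then have "La \<notin> set w" and IH: "act_word t w = act_word t (klein_nf w)" by auto
  from klein_nf_cases[OF this(1)] have "act_word t (klein_mul l (klein_nf w)) = t l \<circ> act_word t (klein_nf w)"
    using klein_mult[OF assms(1)] klein_square[OF assms(1)] Cons.prems
    by (cases l) (auto simp: fun_eq_iff)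
  then show ?case using IH by (simp add: klein_nf_def)
qed (simp add: klein_nf_def)

section \<open>Wreath recursion\<close>

fun section_letter :: "bool \<Rightarrow> letter \<Rightarrow> letter list" where
  "section_letter x La = []"
| "section_letter x Lb = (if x then [Lc] else [La])"
| "section_letter x Lc = (if x then [Ld] else [La])"
| "section_letter x Ld = (if x then [Lb] else [])"

definition flip :: "letter \<Rightarrow> bool \<Rightarrow> bool" where
  "flip l x = (if l = La then \<not> x else x)"

text \<open>The last letter acts first, so \<open>l\<close> meets the vertex to which
  \<open>w\<close> has already moved \<open>x\<close>.\<close>

fun section_word :: "bool \<Rightarrow> letter list \<Rightarrow> letter list" where
  "section_word x [] = []"
| "section_word x (l # w) = section_letter (foldr flip w x) l @ section_word x w"

text \<open>Sections of \<open>Lb\<close>, \<open>Lc\<close>, \<open>Ld\<close> have at most one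
  letter and those of \<open>La\<close> none.\<close>

lemma length_section_word: "length (section_word x w) + count_list w La \<le> length w"
proof (induction w)
  case (Cons l w)
  then show ?case by (cases l) auto
qed simp

lemma length_section_word_less: "La \<in> set w \<Longrightarrow> length (section_word x w) < length w"
  using length_section_word[of x w] count_list_0_iff[of w La] by linarith

section \<open>The four letters acting on binary words\<close>

fun grig :: "letter \<Rightarrow> bool list \<Rightarrow> bool list" where
  "grig La = ga" | "grig Lb = gb" | "grig Lc = gc" | "grig Ld = gd"

lemma ga_ga [simp]: "ga (ga w) = w"
  by (cases w) auto

lemma klein_grig: "klein grig"
proof -
  \<comment> \<open>One induction for all identities: below the vertex 1 the letters
    \<open>b\<close>, \<open>c\<close>, \<open>d\<close> become \<open>c\<close>, \<open>d\<close>,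
    \<open>b\<close>, which turns each identity into another one of the list.\<close>
  have "gb (gb w) = w \<and> gc (gc w) = w \<and> gd (gd w) = w \<and>
    gb (gc w) = gd w \<and> gc (gd w) = gb w \<and> gd (gb w) = gc w" for w
  proof (induction w)
    case (Cons x w)
    then show ?case by (cases x) auto
  qed simp
  then show ?thesis
    unfolding klein_def by (metis ga_ga grig.simps letter.exhaust)
qed

lemma grig_Cons: "grig l (x # v) = flip l x # act_word grig (section_letter x l) v"
  by (cases l; cases x) (auto simp: flip_def)

lemma act_word_grig_Cons:
  "act_word grig w (x # v) = foldr flip w x # act_word grig (section_word x w) v"
  by (induction w) (simp_all add: grig_Cons)

text \<open>A cell \<open>(x, i, j)\<close> is an element \<open>x\<close> of the free group of rank two in one of four sheets
  \<open>(i, j)\<close>. The Klein four-group permutes the sheets regularly, while \<open>a\<close> pairs them into two edges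
  carrying the two free generators: this is the Schreier graph of an index-four free subgroup
  of the free product of the group of order two and the Klein four-group. Words which are not
  reduced are junk; on them \<open>a\<close> is defined so as to remain an involution.\<close>

type_synonym cell = "(nat \<times> bool) list \<times> bool \<times> bool"

fun leaf :: "letter \<Rightarrow> cell \<Rightarrow> cell" where
  "leaf La (x, i, j) = (if free_red x = x then free_step (of_bool i, \<not> j) x else x, i, \<not> j)"
| "leaf Lb (x, i, j) = (x, \<not> i, j)"
| "leaf Lc (x, i, j) = (x, i, \<not> j)"
| "leaf Ld (x, i, j) = (x, \<not> i, \<not> j)"

text \<open>The self-similar action of the four letters on the first \<open>n\<close> levels of the tree, with a
  copy of the action \<open>leaf\<close> in place of the subtree below each vertex of level \<open>n\<close>.\<close>

primrec level :: "nat \<Rightarrow> letter \<Rightarrow> bool list \<times> cell \<Rightarrow> bool list \<times> cell" where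
  "level 0 l = (\<lambda>(v, y). (v, leaf l y))"
| "level (Suc n) l = (\<lambda>(v, y). case v of [] \<Rightarrow> ([], y)
     | x # v' \<Rightarrow> apfst (Cons (flip l x)) (act_word (level n) (section_letter x l) (v', y)))"

lemma level_0 [simp]: "level 0 l (v, y) = (v, leaf l y)"
  by simp

lemma level_Nil [simp]: "level (Suc n) l ([], y) = ([], y)"
  by simp

lemma level_Cons: "level (Suc n) l (apfst (Cons x) q) =
  apfst (Cons (flip l x)) (act_word (level n) (section_letter x l) q)"
  by (cases q) simp

declare level.simps [simp del]

lemma point_cases:
  fixes p :: "bool list \<times> 'p"
  obtains y where "p = ([], y)" | x q where "p = apfst (Cons x) q"
proof (cases "fst p")
  case Nil
  then show ?thesis using that(1)[of "snd p"] by (simp add: prod_eq_iff)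
next
  case (Cons x v)
  then show ?thesis using that(2)[of x "(v, snd p)"] by (simp add: prod_eq_iff)
qed

section \<open>Relations and sections of the level actions\<close>

lemma klein_leaf: "klein leaf"
proof -
  have "leaf l (leaf l p) = p" for l p
    by (cases p; cases l) (auto simp: reduced_free_step free_step_cancel)
  then show ?thesis by (auto simp: klein_def)
qed

lemma klein_level: "klein (level n)"
proof (induction n)
  case 0
  then show ?case using klein_leaf by (auto simp: klein_def)
next
  case (Suc n)
  have "level (Suc n) l (level (Suc n) l p) = p" for l p
    by (cases p rule: point_cases; cases l) (simp_all add: level_Cons flip_def klein_square[OF Suc])
  moreover have "level (Suc n) Lb (level (Suc n) Lc p) = level (Suc n) Ld p"
    "level (Suc n) Lc (level (Suc n) Ld p) = level (Suc n) Lb p"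
    "level (Suc n) Ld (level (Suc n) Lb p) = level (Suc n) Lc p" for p
    by (cases p rule: point_cases;
        simp add: level_Cons flip_def klein_square[OF Suc] klein_mult[OF Suc])+
  ultimately show ?case unfolding klein_def by blast
qed

lemma act_word_level_0: "act_word (level 0) w (v, y) = (v, act_word leaf w y)"
  by (induction w) simp_all

lemma act_word_level_Nil: "act_word (level (Suc n)) w ([], y) = ([], y)"
  by (induction w) simp_all

lemma act_word_level_Cons: "act_word (level (Suc n)) w (apfst (Cons x) q) =
  apfst (Cons (foldr flip w x)) (act_word (level n) (section_word x w) q)"
  by (induction w) (simp_all add: level_Cons)

text \<open>The contraction argument: a word containing \<open>a\<close> has strictly shorter sections.\<close>

theorem eventually_trivial:
  assumes "act_word grig w = id"
  shows "\<exists>N. \<forall>n\<ge>N. act_word (level n) w = id"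
  using assms
proof (induction "length w" arbitrary: w rule: less_induct)
  case less
  show ?case
  proof (cases "La \<in> set w")
    case False
    have "act_word grig (klein_nf w) = id"
      using act_word_klein_nf[OF klein_grig False] less.prems by simp
    \<comment> \<open>Without \<open>La\<close> the Klein relations alone reduce the word to at most
      one letter. No single letter acts trivially, so nothing is left, and the same reduction is
      valid in every \<open>level n\<close>.\<close>
    moreover have "gb [False, False] \<noteq> [False, False]" "gc [False, False] \<noteq> [False, False]"
      "gd [True, False, False] \<noteq> [True, False, False]" by simp_all
    then have "gb \<noteq> id" "gc \<noteq> id" "gd \<noteq> id" by (metis id_apply)+
    ultimately have "klein_nf w = []"
      using klein_nf_cases[OF False] by auto
    then show ?thesis
      using act_word_klein_nf[OF klein_level False] by (metis act_word_simps(1))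
  next
    case True
    have *: "foldr flip w x = x" "act_word grig (section_word x w) = id" for x
      using fun_cong[OF less.prems, of "x # _"] by (auto simp: act_word_grig_Cons fun_eq_iff)
    have "\<exists>N. \<forall>n\<ge>N. act_word (level n) (section_word x w) = id" for x
      using less.hyps[OF length_section_word_less[OF True]] * by blast
    then obtain N where N: "\<And>x n. n \<ge> N x \<Longrightarrow> act_word (level n) (section_word x w) = id"
      by metis
    \<comment> \<open>Passing to a section uses up one level, hence \<open>Suc\<close>.\<close>
    have "act_word (level n) w = id" if n: "n \<ge> Suc (max (N False) (N True))" for n
    proof -
      obtain m where m: "n = Suc m" using n by (cases n) auto
      have "m \<ge> N x" for x using n m by (cases x) auto
      then have "act_word (level n) w (v, y) = (v, y)" for v y
        using N *(1) m act_word_level_Cons[of m w "hd v" "(tl v, y)"]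
        by (cases v) (simp_all add: act_word_level_Nil)
      then show ?thesis by (auto simp: fun_eq_iff)
    qed
    then show ?thesis by blast
  qed
qed

text \<open>On the subtree below the vertex 1, the words \<open>aba\<close>, \<open>d\<close>, \<open>b\<close>, \<open>c\<close> act as \<open>a\<close>, \<open>b\<close>, \<open>c\<close>, \<open>d\<close>.\<close>

fun lift :: "letter \<Rightarrow> letter list" where
  "lift La = [La, Lb, La]" | "lift Lb = [Ld]" | "lift Lc = [Lb]" | "lift Ld = [Lc]"

lemma act_word_lift: "act_word (level (Suc n)) (concat (map lift w)) (apfst (Cons True) q) =
  apfst (Cons True) (act_word (level n) w q)"
proof (induction w)
  case (Cons l w)
  then show ?case by (cases l) (simp_all add: level_Cons flip_def)
qed simp

text \<open>Self-replication: applying \<open>lift\<close> once per level moves a word from the leaf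
  action to the vertex \<open>replicate n True\<close> while fixing that vertex. Surjectivity onto
  the free group comes from here.\<close>

lemma level_realises_leaf:
  "\<exists>w'. \<forall>y. act_word (level n) w' (replicate n True, y) = (replicate n True, act_word leaf w y)"
proof (induction n)
  case 0
  then show ?case using act_word_level_0[of w "[]"] by auto
next
  case (Suc n)
  then obtain w' where
    "\<And>y. act_word (level n) w' (replicate n True, y) = (replicate n True, act_word leaf w y)"
    by blast
  then show ?case
    using act_word_lift[of n w' "(replicate n True, _)"]
    by (intro exI[of _ "concat (map lift w')"]) simp
qed

section \<open>The cocycle\<close>

text \<open>The genuine points: a vertex of level exactly \<open>n\<close> and a reduced word as
  label.\<close>

definition points :: "nat \<Rightarrow> (bool list \<times> cell) set" where
  "points n = {(v, x, s). length v = n \<and> x \<in> carrier (free_group {0, 1})}"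

definition translate :: "(nat \<times> bool) list \<Rightarrow> bool list \<times> cell \<Rightarrow> bool list \<times> cell" where
  "translate z = (\<lambda>(v, x, s). (v, free_red (x @ z), s))"

lemma act_word_closed:
  assumes "\<And>l p. p \<in> S \<Longrightarrow> t l p \<in> S" "p \<in> S"
  shows "act_word t w p \<in> S"
  by (induction w) (simp_all add: assms)

lemma act_word_commute:
  assumes "\<And>l p. p \<in> S \<Longrightarrow> t l p \<in> S" "\<And>l p. p \<in> S \<Longrightarrow> t l (f p) = f (t l p)" "p \<in> S"
  shows "act_word t w (f p) = f (act_word t w p)"
  by (induction w) (simp_all add: assms act_word_closed[where S = S])

lemma points_Suc: "apfst (Cons x) q \<in> points (Suc n) \<longleftrightarrow> q \<in> points n"
  by (cases q) (simp add: points_def)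

lemma level_closed: "p \<in> points n \<Longrightarrow> level n l p \<in> points n"
proof (induction n arbitrary: l p)
  case 0
  obtain x i j where p: "p = ([], x, i, j)" "x \<in> carrier (free_group {0, 1})"
    using 0 by (auto simp: points_def)
  have "free_step (of_bool i, \<not> j) x = [(of_bool i, \<not> j)] \<otimes>\<^bsub>free_group {0, 1}\<^esub> x"
    using p by (simp add: free_group_def free_red_Cons)
  moreover have "[(of_bool i, \<not> j)] \<in> carrier (free_group {0, 1::nat})"
    by (simp add: free_group_def)
  ultimately have "free_step (of_bool i, \<not> j) x \<in> carrier (free_group {0, 1})"
    using p group.is_monoid[OF group_free_group] monoid.m_closed by metis
  then show ?case using p by (cases l) (auto simp: points_def)
next
  case (Suc n)
  obtain x q where p: "p = apfst (Cons x) q" "q \<in> points n"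
  proof (cases p rule: point_cases)
    case (1 y)
    then show ?thesis using Suc.prems by (auto simp: points_def)
  next
    case (2 x q)
    then show ?thesis using Suc.prems that by (simp add: points_Suc)
  qed
  have "act_word (level n) (section_letter x l) q \<in> points n"
    using Suc.IH p(2) by (rule act_word_closed)
  then show ?case
    using p(1) by (simp add: level_Cons points_Suc)
qed

text \<open>The letters multiply the label on the left and \<open>translate\<close> multiplies it on
  the right, so the two commute by associativity.\<close>

lemma level_translate: "p \<in> points n \<Longrightarrow> level n l (translate z p) = translate z (level n l p)"
proof (induction n arbitrary: l p)
  case 0
  obtain x i j where p: "p = ([], x, i, j)" "free_red x = x"
    using 0 by (auto simp: points_def free_group_def)
  have "free_step k (free_red (x @ z)) = free_red (free_step k x @ z)" for k
    using free_red_append_left[of "k # x" z] p(2) by (simp add: free_red_Cons)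
  then show ?case using p by (cases l) (auto simp: translate_def)
next
  case (Suc n)
  obtain x q where p: "p = apfst (Cons x) q" "q \<in> points n"
  proof (cases p rule: point_cases)
    case (1 y)
    then show ?thesis using Suc.prems by (auto simp: points_def)
  next
    case (2 x q)
    then show ?thesis using Suc.prems that by (simp add: points_Suc)
  qed
  have "act_word (level n) (section_letter x l) (translate z q) =
    translate z (act_word (level n) (section_letter x l) q)"
    using level_closed Suc.IH p(2) by (rule act_word_commute)
  moreover have "translate z (apfst (Cons x') q') = apfst (Cons x') (translate z q')" for x' q'
    by (cases q') (simp add: translate_def split: prod.split)
  ultimately show ?case using p(1) by (simp add: level_Cons)
qed

text \<open>Names the orbit of a point under translations by the free group; on
  \<open>points n\<close> there are only finitely many.\<close>

definition sheet :: "bool list \<times> cell \<Rightarrow> bool list \<times> bool \<times> bool" where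
  "sheet = (\<lambda>(v, x, s). (v, s))"

lemma sheet_translate [simp]: "sheet (translate z p) = sheet p"
  by (auto simp: sheet_def translate_def split: prod.splits)

text \<open>Both points are translates of the one with empty label, which avoids dividing one label
  by the other.\<close>

lemma sheet_eq_imp_translate:
  assumes "p \<in> points n" "q \<in> points n" "sheet p = sheet q"
  shows "\<exists>r\<in>points n. \<exists>z z'. p = translate z r \<and> q = translate z' r"
proof -
  obtain v x s x' where "p = (v, x, s)" "q = (v, x', s)"
    using assms(3) by (auto simp: sheet_def split: prod.splits)
  then show ?thesis using assms(1,2)
    by (intro bexI[of _ "(v, [], s)"] exI[of _ x] exI[of _ x'])
       (auto simp: translate_def points_def free_group_def)
qed

section \<open>A finite-index subgroup mapping onto the free group\<close>

lemma finite_image_if_factors: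
  assumes "finite (k ` S)" "\<And>x y. x \<in> S \<Longrightarrow> y \<in> S \<Longrightarrow> k x = k y \<Longrightarrow> c x = c y"
  shows "finite (c ` S)"
proof (rule finite_subset)
  show "c ` S \<subseteq> (\<lambda>z. c (inv_into S k z)) ` (k ` S)"
  proof
    fix y assume "y \<in> c ` S"
    then obtain x where x: "x \<in> S" "y = c x" by blast
    then have "c (inv_into S k (k x)) = c x"
      by (intro assms(2)) (auto intro: inv_into_into f_inv_into_f)
    then show "y \<in> (\<lambda>z. c (inv_into S k z)) ` (k ` S)" using x by force
  qed
qed (use assms(1) in simp)

text \<open>The stabiliser \<open>H\<close> of one sheet has finite index. That sheet is a copy of
  the free group on which \<open>H\<close> commutes with all right translations, hence acts by left
  multiplications; the multiplier is the homomorphism \<open>h\<close>.\<close>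

theorem large_if_onto_level:
  fixes G (structure)
  assumes "group G"
    and mult: "\<And>g h. g \<in> carrier G \<Longrightarrow> h \<in> carrier G \<Longrightarrow> \<theta> (g \<otimes> h) = \<theta> g \<circ> \<theta> h"
    and img: "\<theta> ` carrier G = range (act_word (level n))"
  shows "large G"
proof -
  interpret group G by fact
  let ?F = "free_group {0, 1::nat}"
  interpret F: group ?F by (rule group_free_group)
  \<comment> \<open>The vertex is the one at which \<open>level_realises_leaf\<close> supplies
    words; the empty label makes the label of an image of \<open>p0\<close> the multiplier
    itself.\<close>
  define p0 :: "bool list \<times> cell" where "p0 = (replicate n True, [], False, False)"
  have p0: "p0 \<in> points n"
    by (auto simp: p0_def points_def free_group_def)
  have ex_word: "\<exists>w. \<theta> g = act_word (level n) w" if "g \<in> carrier G" for g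
    using imageI[OF that, of \<theta>] unfolding img by (rule rangeE) blast
  have closed: "\<theta> g p \<in> points n" if "g \<in> carrier G" "p \<in> points n" for g p
  proof -
    obtain w where "\<theta> g = act_word (level n) w" using ex_word \<open>g \<in> carrier G\<close> by blast
    then show ?thesis
      using act_word_closed[where S = "points n" and t = "level n", OF level_closed that(2)] by simp
  qed
  have equiv: "\<theta> g (translate z p) = translate z (\<theta> g p)"
    if "g \<in> carrier G" "p \<in> points n" for g p z
  proof -
    obtain w where "\<theta> g = act_word (level n) w" using ex_word \<open>g \<in> carrier G\<close> by blast
    then show ?thesis
      using act_word_commute[where S = "points n" and t = "level n" and f = "translate z",
          OF level_closed level_translate that(2)] by simp
  qed
  \<comment> \<open>By equivariance the group permutes the sheets.\<close>
  have sheets: "sheet (\<theta> g p) = sheet (\<theta> g q)"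
    if "g \<in> carrier G" "p \<in> points n" "q \<in> points n" "sheet p = sheet q" for g p q
    using sheet_eq_imp_translate[OF that(2-4)] equiv[OF that(1)] by auto
  \<comment> \<open>Multiplicativity makes \<open>\<theta> \<one>\<close> idempotent, and an
    idempotent bijection is the identity.\<close>
  have one: "\<theta> \<one> = id"
  proof -
    obtain w where w: "\<theta> \<one> = act_word (level n) w" using ex_word[OF one_closed] by blast
    have "\<theta> \<one> \<circ> \<theta> \<one> = \<theta> \<one>" using mult[of \<one> \<one>] by simp
    then show ?thesis
      using bij_is_inj[OF bij_act_word[OF klein_level, of n w]] w
      by (metis comp_apply eq_id_iff injD)
  qed
  define H where "H = {g \<in> carrier G. sheet (\<theta> g p0) = sheet p0}"
  define h where "h g = fst (snd (\<theta> g p0))" for g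
  have inv1: "\<theta> g (\<theta> (inv g) p) = p" "\<theta> (inv g) (\<theta> g p) = p" if "g \<in> carrier G" for g p
  proof -
    have "\<theta> g \<circ> \<theta> (inv g) = id" "\<theta> (inv g) \<circ> \<theta> g = id"
      using that one by (simp_all flip: mult)
    then show "\<theta> g (\<theta> (inv g) p) = p" "\<theta> (inv g) (\<theta> g p) = p"
      by (metis comp_apply id_apply)+
  qed
  have H: "subgroup H G"
  proof (rule subgroupI)
    show "H \<noteq> {}" using one by (auto simp: H_def)
    show "inv g \<in> H" if "g \<in> H" for g
      using that sheets[of "inv g" "\<theta> g p0" p0] closed[of g p0] p0 inv1 by (auto simp: H_def)
    show "g \<otimes> g' \<in> H" if "g \<in> H" "g' \<in> H" for g g'
      using that sheets[of g "\<theta> g' p0" p0] closed[of g' p0] p0 mult by (auto simp: H_def)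
  qed (auto simp: H_def)
  have "finite ((\<lambda>g. H #> g) ` carrier G)"
  proof (rule finite_image_if_factors)
    \<comment> \<open>For right cosets of a stabiliser the invariant is the image of the base sheet
      under \<open>inv g\<close>: equal images mean that \<open>g' \<otimes> inv g\<close> lies in
      \<open>H\<close>.\<close>
    have "(\<lambda>g. sheet (\<theta> (inv g) p0)) ` carrier G \<subseteq> {v. set v \<subseteq> UNIV \<and> length v = n} \<times> UNIV"
    proof clarsimp
      fix g v i j assume "g \<in> carrier G" "(v, i, j) = sheet (\<theta> (inv g) p0)"
      then show "length v = n"
        using closed[of "inv g" p0] p0 by (auto simp: sheet_def points_def split: prod.splits)
    qed
    then show "finite ((\<lambda>g. sheet (\<theta> (inv g) p0)) ` carrier G)"
      by (rule finite_subset) (intro finite_cartesian_product finite_lists_length_eq finite)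
    fix g g' assume g: "g \<in> carrier G" "g' \<in> carrier G"
      and eq: "sheet (\<theta> (inv g) p0) = sheet (\<theta> (inv g') p0)"
    have "sheet (\<theta> (g' \<otimes> inv g) p0) = sheet p0"
      using sheets[OF g(2) _ _ eq] closed p0 g mult inv1 by simp
    then have "g' \<otimes> inv g \<in> H" using g by (simp add: H_def)
    from rcosI[OF this subgroup.subset[OF H] g(1)] have "g' \<in> H #> g"
      using g by (simp add: m_assoc)
    then show "H #> g = H #> g'" using g H by (intro repr_independence) auto
  qed
  moreover have "RCOSETS G H = (\<lambda>g. H #> g) ` carrier G"
    by (auto simp: RCOSETS_def)
  ultimately have fin: "finite (RCOSETS G H)" by simp
  have h: "\<theta> g p0 = translate (h g) p0" "h g \<in> carrier ?F" if "g \<in> H" for g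
    using that closed[of g p0] p0
    by (auto simp: H_def h_def sheet_def p0_def translate_def points_def free_group_def split: prod.splits)
  have hom: "h \<in> hom (G\<lparr>carrier := H\<rparr>) ?F"
  proof (rule homI)
    fix g g' assume "g \<in> carrier (G\<lparr>carrier := H\<rparr>)" "g' \<in> carrier (G\<lparr>carrier := H\<rparr>)"
    then have g: "g \<in> H" "g' \<in> H" "g \<in> carrier G" "g' \<in> carrier G" by (simp_all add: H_def)
    have "\<theta> (g \<otimes> g') p0 = \<theta> g (translate (h g') p0)"
      using mult[OF g(3,4)] h(1)[OF g(2)] by simp
    \<comment> \<open>Equivariance moves \<open>translate (h g')\<close> outside. As translation
      appends on the right, the label becomes \<open>h g\<close> followed by \<open>h g'\<close>, so
      the order of the factors is preserved.\<close>
    also have "\<dots> = translate (h g') (translate (h g) p0)"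
      using equiv[OF g(3) p0] h(1)[OF g(1)] by simp
    finally have "h (g \<otimes> g') = free_red (free_red (h g) @ h g')"
      by (simp add: h_def[of "g \<otimes> g'"] translate_def p0_def)
    then show "h (g \<otimes>\<^bsub>G\<lparr>carrier := H\<rparr>\<^esub> g') = h g \<otimes>\<^bsub>?F\<^esub> h g'"
      by (simp add: free_group_def)
  qed (use h in simp)
  interpret h: group_hom "G\<lparr>carrier := H\<rparr>" ?F h
    by (intro group_hom.intro group_hom_axioms.intro subgroup.subgroup_is_group[OF H group_axioms]
        F.group_axioms hom)
  have gen: "[l] \<in> h ` H"
    if "act_word leaf w ([], False, False) = ([l], False, False)" for w l
  proof -
    obtain w' where "\<forall>y. act_word (level n) w' (replicate n True, y) = (replicate n True, act_word leaf w y)"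
      using level_realises_leaf[of n w] by blast
    then have "act_word (level n) w' p0 = (replicate n True, [l], False, False)"
      using that by (simp add: p0_def)
    moreover obtain g where "g \<in> carrier G" "\<theta> g = act_word (level n) w'"
      using rangeI[of "act_word (level n)" w'] unfolding img[symmetric] by (elim imageE) auto
    ultimately have "g \<in> H" "h g = [l]" by (auto simp: H_def h_def sheet_def p0_def)
    then show ?thesis by force
  qed
  \<comment> \<open>The two words are loops at the base sheet of the Schreier graph, each crossing
    one of the two edges of \<open>a\<close> once, in the positive direction.\<close>
  have "[(x, True)] \<in> h ` H" if "x \<in> {0, 1}" for x
    using that gen[of "[Lc, La]" "(0, True)"] gen[of "[Ld, La, Lb]" "(1, True)"]
    by (auto simp: free_step_def)
  then have "h ` H = carrier ?F"
    using h.img_is_subgroup by (intro free_group_subgroup_UNIV) auto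
  then show ?thesis
    unfolding large_def using H fin hom by (intro exI[of _ H] conjI exI[of _ "{0, 1}"] exI[of _ h]) auto
qed

section \<open>Finitely presented groups over the Grigorchuk group\<close>

text \<open>Reversal stands for inversion, because the letters will act as involutions.\<close>

definition subst_word :: "('x \<Rightarrow> letter list) \<Rightarrow> ('x \<times> bool) list \<Rightarrow> letter list" where
  "subst_word \<sigma> u = concat (map (\<lambda>(i, b). if b then \<sigma> i else rev (\<sigma> i)) u)"

lemma act_subst_word_free_red:
  assumes "klein t"
  shows "act_word t (subst_word \<sigma> (free_red u)) = act_word t (subst_word \<sigma> u)"
proof -
  have "act_word t (subst_word \<sigma> (free_step l v)) = act_word t (subst_word \<sigma> (l # v))" for l v
    using act_word_rev[OF assms] act_word_rev_right[OF assms]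
    by (cases v) (auto simp: subst_word_def free_step_def fun_eq_iff split: prod.splits)
  then show ?thesis
    by (induction u) (simp_all add: free_red_Cons, simp_all add: subst_word_def)
qed

lemma hom_BijGroup_subst_word:
  assumes "klein t"
  shows "(\<lambda>u. act_word t (subst_word \<sigma> u)) \<in> hom (free_group B) (BijGroup UNIV)"
proof (rule homI)
  fix u v
  have "act_word t (subst_word \<sigma> (u @ v)) = act_word t (subst_word \<sigma> u) \<circ> act_word t (subst_word \<sigma> v)"
    by (simp add: subst_word_def)
  then show "act_word t (subst_word \<sigma> (u \<otimes>\<^bsub>free_group B\<^esub> v)) =
    act_word t (subst_word \<sigma> u) \<otimes>\<^bsub>BijGroup UNIV\<^esub> act_word t (subst_word \<sigma> v)"
    using bij_act_word[OF assms]
    by (simp add: free_group_def act_subst_word_free_red[OF assms] BijGroup_def Bij_def compose_def fun_eq_iff)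
qed (use bij_act_word[OF assms] in \<open>simp add: BijGroup_def Bij_def\<close>)

section \<open>Factoring homomorphisms through a presentation\<close>

lemma normal_closure_subset_kernel:
  assumes "group_hom F K e" "R \<subseteq> kernel F K e"
  shows "normal_closure F R \<subseteq> kernel F K e"
proof -
  interpret group_hom F K e by fact
  interpret N: normal "kernel F K e" F by (rule normal_kernel)
  show ?thesis
    unfolding normal_closure_def
    using N.inv_op_closed2 assms(2)
    by (intro G.generate_subgroup_incl[OF _ N.subgroup_axioms]) auto
qed

lemma hom_factor:
  assumes "group_hom F G \<phi>" "group_hom F K e" "\<phi> ` carrier F = carrier G"
    and "kernel F G \<phi> \<subseteq> kernel F K e"
  shows "\<exists>\<theta> \<in> hom G K. \<forall>u\<in>carrier F. \<theta> (\<phi> u) = e u"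
proof -
  interpret p: group_hom F G \<phi> by fact
  interpret e: group_hom F K e by fact
  have wd: "e u = e v" if "u \<in> carrier F" "v \<in> carrier F" "\<phi> u = \<phi> v" for u v
  proof -
    have "u \<otimes>\<^bsub>F\<^esub> inv\<^bsub>F\<^esub> v \<in> kernel F G \<phi>" using that by (simp add: kernel_def)
    then have "e (u \<otimes>\<^bsub>F\<^esub> inv\<^bsub>F\<^esub> v) = \<one>\<^bsub>K\<^esub>"
      using subsetD[OF assms(4)] by (simp add: kernel_def)
    then have "e u \<otimes>\<^bsub>K\<^esub> inv\<^bsub>K\<^esub> e v = \<one>\<^bsub>K\<^esub>" using that by simp
    then show ?thesis using that by (metis e.H.inv_closed e.H.inv_equality e.H.inv_inv e.hom_closed)
  qed
  define \<theta> where "\<theta> g = e (inv_into (carrier F) \<phi> g)" for g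
  have th: "\<theta> (\<phi> u) = e u" if "u \<in> carrier F" for u
    unfolding \<theta>_def using that by (intro wd) (auto intro: inv_into_into f_inv_into_f)
  have "\<theta> \<in> hom G K"
  proof (rule homI)
    fix g assume "g \<in> carrier G"
    then show "\<theta> g \<in> carrier K" using th assms(3) by (metis e.hom_closed imageE)
    fix g' assume "g' \<in> carrier G"
    obtain u v where "u \<in> carrier F" "v \<in> carrier F" "g = \<phi> u" "g' = \<phi> v"
      using \<open>g \<in> carrier G\<close> \<open>g' \<in> carrier G\<close> assms(3) by blast
    then show "\<theta> (g \<otimes>\<^bsub>G\<^esub> g') = \<theta> g \<otimes>\<^bsub>K\<^esub> \<theta> g'"
      using th[of "u \<otimes>\<^bsub>F\<^esub> v"] th by simp
  qed
  then show ?thesis using th by blast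
qed

section \<open>The Grigorchuk group as the set of actions of words\<close>

lemma grig_in_Bij: "act_word grig w \<in> carrier (BijGroup UNIV)"
  using bij_act_word[OF klein_grig] by (simp add: BijGroup_def Bij_def)

lemma mult_grig: "act_word grig u \<otimes>\<^bsub>BijGroup UNIV\<^esub> act_word grig v = act_word grig (u @ v)"
  using bij_act_word[OF klein_grig]
  by (simp add: BijGroup_def Bij_def compose_def fun_eq_iff)

lemma one_grig: "\<one>\<^bsub>BijGroup UNIV\<^esub> = act_word grig []"
  by (simp add: BijGroup_def fun_eq_iff)

text \<open>The generators are involutions, so words without inverse letters already form a
  subgroup.\<close>

lemma carrier_grigorchuk: "carrier grigorchuk = range (act_word grig)"
proof -
  let ?P = "BijGroup (UNIV :: bool list set)"
  interpret P: group ?P by (rule group_BijGroup)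
  have inv: "inv\<^bsub>?P\<^esub> act_word grig w = act_word grig (rev w)" for w
    using act_word_rev[OF klein_grig]
    by (intro P.inv_equality grig_in_Bij)
       (simp add: mult_grig one_grig fun_eq_iff del: act_word_simps(3), simp)
  have gens: "{ga, gb, gc, gd} = (\<lambda>l. act_word grig [l]) ` UNIV"
  proof -
    have "l \<in> {La, Lb, Lc, Ld}" for l by (cases l) simp_all
    then have letters: "(UNIV :: letter set) = {La, Lb, Lc, Ld}" by blast
    show ?thesis unfolding letters by simp
  qed
  have "generate ?P {ga, gb, gc, gd} = range (act_word grig)"
  proof
    have "subgroup (range (act_word grig)) ?P"
      using one_grig by (intro P.subgroupI) (auto simp: grig_in_Bij inv mult_grig simp del: act_word_simps(3))
    moreover have "{ga, gb, gc, gd} \<subseteq> range (act_word grig)"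
      unfolding gens by (intro image_subsetI rangeI)
    ultimately show "generate ?P {ga, gb, gc, gd} \<subseteq> range (act_word grig)"
      by (rule P.generate_subgroup_incl[rotated])
    have "act_word grig w \<in> generate ?P {ga, gb, gc, gd}" for w
    proof (induction w)
      case Nil
      show ?case unfolding one_grig[symmetric] by (rule generate.one)
    next
      case (Cons l w)
      have "act_word grig [l] \<in> generate ?P {ga, gb, gc, gd}"
        unfolding gens by (rule generate.incl, rule range_eqI[of _ _ l], rule refl)
      from generate.eng[OF this Cons] show ?case by (simp add: mult_grig del: act_word_simps(2,3))
    qed
    then show "range (act_word grig) \<subseteq> generate ?P {ga, gb, gc, gd}" by (rule image_subsetI)
  qed
  then show ?thesis by (simp add: grigorchuk_def)
qed

lemma group_grigorchuk: "group grigorchuk"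
proof -
  interpret P: group "BijGroup (UNIV :: bool list set)" by (rule group_BijGroup)
  have "ga \<in> carrier (BijGroup UNIV)" "gb \<in> carrier (BijGroup UNIV)"
    "gc \<in> carrier (BijGroup UNIV)" "gd \<in> carrier (BijGroup UNIV)"
    using grig_in_Bij[of "[La]"] grig_in_Bij[of "[Lb]"] grig_in_Bij[of "[Lc]"] grig_in_Bij[of "[Ld]"]
    by simp_all
  then show ?thesis
    unfolding grigorchuk_def
    by (intro subgroup.subgroup_is_group P.generate_is_subgroup P.group_axioms) auto
qed

text \<open>Choosing a word for the image of each free generator turns the homomorphism into a
  substitution, which can then be evaluated in \<open>level n\<close> as well.\<close>

lemma hom_grigorchuk_eq_subst_word:
  assumes "f \<in> hom (free_group B) grigorchuk"
  obtains \<sigma> where "\<And>u. u \<in> carrier (free_group B) \<Longrightarrow> f u = act_word grig (subst_word \<sigma> u)"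
proof -
  let ?F = "free_group B"
  interpret f: group_hom ?F grigorchuk f
    using assms group_free_group group_grigorchuk by (simp add: group_hom_def group_hom_axioms_def)
  have "\<exists>w. f [(i, True)] = act_word grig w" if "i \<in> B" for i
    using f.hom_closed[of "[(i, True)]"] that carrier_grigorchuk by (auto simp: free_group_def)
  then obtain \<sigma> where \<sigma>: "\<And>i. i \<in> B \<Longrightarrow> f [(i, True)] = act_word grig (\<sigma> i)" by metis
  have mult: "act_word grig u \<otimes>\<^bsub>grigorchuk\<^esub> act_word grig v = act_word grig (u @ v)" for u v
    unfolding grigorchuk_def using mult_grig by simp
  have one: "\<one>\<^bsub>grigorchuk\<^esub> = act_word grig []"
    unfolding grigorchuk_def using one_grig by simp
  have neg: "f [(i, False)] = act_word grig (rev (\<sigma> i))" if "i \<in> B" for i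
  proof -
    have c: "[(i, True)] \<in> carrier ?F" "[(i, False)] \<in> carrier ?F"
      using that by (auto simp: free_group_def)
    have "[(i, False)] \<otimes>\<^bsub>?F\<^esub> [(i, True)] = \<one>\<^bsub>?F\<^esub>"
      by (simp add: free_group_def free_red_Cons free_step_def)
    then have "f [(i, False)] \<otimes>\<^bsub>grigorchuk\<^esub> f [(i, True)] = \<one>\<^bsub>grigorchuk\<^esub>"
      using c by (metis f.hom_mult f.hom_one)
    moreover have "act_word grig (rev (\<sigma> i)) \<otimes>\<^bsub>grigorchuk\<^esub> f [(i, True)] = \<one>\<^bsub>grigorchuk\<^esub>"
      using act_word_rev[OF klein_grig] by (simp add: \<sigma> that mult one fun_eq_iff)
    ultimately show ?thesis
      using c f.hom_closed carrier_grigorchuk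
      by (metis f.H.inv_equality rangeI)
  qed
  have "f u = act_word grig (subst_word \<sigma> u)" if "u \<in> carrier ?F" for u
    using that
  proof (induction u)
    case Nil
    then show ?case using f.hom_one one by (simp add: free_group_def subst_word_def)
  next
    case (Cons l u)
    note lu = free_group_Cons[OF Cons.prems]
    obtain i b where l: "l = (i, b)" by (cases l)
    have "i \<in> B" using lu(1) l by (simp add: free_group_def)
    then have "f [l] = act_word grig (subst_word \<sigma> [l])"
      using \<sigma> neg l by (simp add: subst_word_def)
    moreover have "f (l # u) = f [l] \<otimes>\<^bsub>grigorchuk\<^esub> f u"
      using lu f.hom_mult by metis
    ultimately show ?case using Cons.IH[OF lu(2)] mult by (simp add: subst_word_def)
  qed
  then show ?thesis by (rule that)
qed

section \<open>From a finite presentation to a level group\<close>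

theorem theorem1p6:
  fixes G :: "('a, 'b) monoid_scheme"
  assumes "group G"
    and "finitely_presented G"
    and "\<exists>f. f \<in> hom G grigorchuk \<and> f ` carrier G = carrier grigorchuk"
  shows "large G"
proof -
  obtain k \<phi> R where \<phi>: "\<phi> \<in> hom (free_group {..<k::nat}) G"
    "\<phi> ` carrier (free_group {..<k}) = carrier G"
    and R: "finite R" "R \<subseteq> carrier (free_group {..<k})"
    "kernel (free_group {..<k}) G \<phi> = normal_closure (free_group {..<k}) R"
    using assms(2) unfolding finitely_presented_def by blast
  let ?F = "free_group {..<k}"
  interpret F: group ?F by (rule group_free_group)
  interpret G: group G by fact
  interpret p: group_hom ?F G \<phi>
    using \<phi>(1) by unfold_locales
  obtain f where f: "f \<in> hom G grigorchuk" "f ` carrier G = carrier grigorchuk"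
    using assms(3) by blast
  interpret f: group_hom G grigorchuk f
    using f(1) G.group_axioms group_grigorchuk by (simp add: group_hom_def group_hom_axioms_def)
  have "f \<circ> \<phi> \<in> hom ?F grigorchuk"
    using \<phi>(1) f(1) by (rule hom_compose)
  from hom_grigorchuk_eq_subst_word[OF this]
  obtain \<sigma> where \<sigma>: "\<And>u. u \<in> carrier ?F \<Longrightarrow> f (\<phi> u) = act_word grig (subst_word \<sigma> u)"
    by auto
  have "\<exists>u\<in>carrier ?F. act_word grig (subst_word \<sigma> u) = grig l" for l
  proof -
    have "grig l \<in> carrier grigorchuk"
      unfolding carrier_grigorchuk by (rule range_eqI[of _ _ "[l]"]) simp
    then obtain g where g: "g \<in> carrier G" "f g = grig l"
      unfolding f(2)[symmetric] by force
    then obtain u where "u \<in> carrier ?F" "\<phi> u = g"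
      unfolding \<phi>(2)[symmetric] by blast
    then show ?thesis using \<sigma>[of u] g by auto
  qed
  then obtain \<tau> where \<tau>: "\<And>l. \<tau> l \<in> carrier ?F"
    "\<And>l. act_word grig (subst_word \<sigma> (\<tau> l)) = grig l" by metis
  \<comment> \<open>The words that have to die in \<open>level n\<close>: the relators, so that the
    map descends to \<open>G\<close>, and a word for each letter saying that \<open>\<tau> l\<close>
    still represents \<open>l\<close>, so that the map is onto. The appended \<open>l\<close> is its
    own inverse.\<close>
  define W where "W = subst_word \<sigma> ` R \<union> (\<lambda>l. subst_word \<sigma> (\<tau> l) @ [l]) ` {La, Lb, Lc, Ld}"
  have "act_word grig w = id" if "w \<in> W" for w
  proof (rule UnE[OF that[unfolded W_def]])
    assume "w \<in> subst_word \<sigma> ` R"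
    then obtain r where r: "r \<in> R" "w = subst_word \<sigma> r" by blast
    have "r \<in> normal_closure ?F R"
      unfolding normal_closure_def
      using r(1) R(2) by (intro generate.incl CollectI exI[of _ "\<one>\<^bsub>?F\<^esub>"] exI[of _ r]) auto
    then have "\<phi> r = \<one>\<^bsub>G\<^esub>" using R(3) by (auto simp: kernel_def)
    moreover have "act_word grig w = f (\<phi> r)" using \<sigma>[of r] r R(2) by auto
    ultimately have "act_word grig w = \<one>\<^bsub>grigorchuk\<^esub>" by (simp only: f.hom_one)
    then show ?thesis by (simp add: grigorchuk_def one_grig)
  next
    assume "w \<in> (\<lambda>l. subst_word \<sigma> (\<tau> l) @ [l]) ` {La, Lb, Lc, Ld}"
    then obtain l where "w = subst_word \<sigma> (\<tau> l) @ [l]" by blast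
    then show ?thesis using \<tau> klein_square[OF klein_grig] by (simp add: fun_eq_iff)
  qed
  then have "\<exists>N. \<forall>w\<in>W. \<forall>n\<ge>N w. act_word (level n) w = id"
    using eventually_trivial by metis
  then obtain N where N: "\<And>w n. w \<in> W \<Longrightarrow> n \<ge> N w \<Longrightarrow> act_word (level n) w = id" by blast
  have "finite W" using R(1) by (simp add: W_def)
  \<comment> \<open>Finitely many relators give finitely many bounds, hence one level that serves
    all of \<open>W\<close>.\<close>
  define n where "n = Max (N ` W)"
  have triv: "act_word (level n) w = id" if "w \<in> W" for w
    unfolding n_def using Max_ge[OF finite_imageI[OF \<open>finite W\<close>] imageI[OF that]] by (rule N[OF that])
  let ?P = "BijGroup (UNIV :: (bool list \<times> cell) set)"
  define e where "e u = act_word (level n) (subst_word \<sigma> u)" for u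
  interpret P: group ?P by (rule group_BijGroup)
  interpret e: group_hom ?F ?P e
    using hom_BijGroup_subst_word[OF klein_level, of n \<sigma> "{..<k}"] unfolding e_def
    by unfold_locales
  have "R \<subseteq> kernel ?F ?P e"
    using R(2) triv by (auto simp: W_def kernel_def e_def BijGroup_def fun_eq_iff)
  then have "kernel ?F G \<phi> \<subseteq> kernel ?F ?P e"
    unfolding R(3) by (intro normal_closure_subset_kernel e.group_hom_axioms)
  then obtain \<theta> where \<theta>: "\<theta> \<in> hom G ?P" "\<And>u. u \<in> carrier ?F \<Longrightarrow> \<theta> (\<phi> u) = e u"
    using hom_factor[OF p.group_hom_axioms e.group_hom_axioms \<phi>(2)] by blast
  show ?thesis
  proof (rule large_if_onto_level[OF assms(1)])
    fix g h assume gh: "g \<in> carrier G" "h \<in> carrier G"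
    then have "\<theta> g \<in> Bij UNIV" "\<theta> h \<in> Bij UNIV"
      using hom_in_carrier[OF \<theta>(1)] by (simp_all add: BijGroup_def)
    then show "\<theta> (g \<otimes>\<^bsub>G\<^esub> h) = \<theta> g \<circ> \<theta> h"
      using hom_mult[OF \<theta>(1) gh] by (simp add: BijGroup_def compose_def fun_eq_iff)
  next
    have ex: "\<exists>u\<in>carrier ?F. e u = act_word (level n) w" for w
    proof (induction w)
      case Nil
      then show ?case
        by (intro bexI[of _ "[]"]) (auto simp: e_def subst_word_def free_group_def)
    next
      case (Cons l w)
      then obtain u where u: "u \<in> carrier ?F" "e u = act_word (level n) w" by blast
      \<comment> \<open>\<open>\<tau> l\<close> was chosen over the Grigorchuk group; membership of
        this word in \<open>W\<close> transfers the choice to \<open>level n\<close>.\<close>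
      have "act_word (level n) (subst_word \<sigma> (\<tau> l) @ [l]) = id"
        by (rule triv) (cases l; simp add: W_def)
      from fun_cong[OF this] have "e (\<tau> l) (level n l q) = q" for q
        by (simp add: e_def)
      then have "e (\<tau> l) q = level n l q" for q
        using klein_square[OF klein_level, of n l q] by metis
      then have "e (\<tau> l) = level n l" by (rule ext)
      moreover have "e (\<tau> l \<otimes>\<^bsub>?F\<^esub> u) = e (\<tau> l) \<circ> e u"
        by (simp add: e_def free_group_def act_subst_word_free_red[OF klein_level])
           (simp add: subst_word_def)
      ultimately show ?case
        using u \<tau>(1) by (intro bexI[of _ "\<tau> l \<otimes>\<^bsub>?F\<^esub> u"]) simp_all
    qed
    have "e ` carrier ?F = range (act_word (level n))"
    proof (intro equalityI image_subsetI)
      show "e u \<in> range (act_word (level n))" for u unfolding e_def by (rule rangeI)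
      show "act_word (level n) w \<in> e ` carrier ?F" for w using ex[of w] by (metis imageI)
    qed
    then show "\<theta> ` carrier G = range (act_word (level n))"
      using \<theta>(2) by (simp add: \<phi>(2)[symmetric] image_image)
  qed
qed

end
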